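(* Let $\mathbb M$ be a manifold equipped with a sub-Riemannian structure, let $\Omega\subset\mathbb M$ be an open set, and let $X,Y$ be two (in general noncommuting) smooth vector fields on $\Omega$, with $Z=[X,Y]=XY-YX$. Then for every $w\in C^2(\Omega)$, $$|\nabla_{XY}Xw|^2+|\nabla_{XY}Yw|^2-\big|X|\nabla_{XY}w|\big|^2-\big|Y|\nabla_{XY}w|\big|^2=\begin{cases}|\nabla_{XY}w|^2\left[\mathcal A^2+\mathcal B^2\right] & \text{in } \{|\nabla_{XY}w|>0\}\cap\Omega,\\ 0 \ \text{ a.e.} & \text{in } \{|\nabla_{XY}w|=0\}\cap\Omega,\end{cases}$$ where, on $\{|\nabla_{XY}w|\neq 0\}$, $$\mathcal A=\operatorname{div}_{XY}(\eta),\qquad \mathcal B=|\nabla_{XY}w|^{-1}\left[-Zw+\langle H_{ess}w\,\tau,\eta\rangle_{XY}\right],$$ $$\eta=|\nabla_{XY}w|^{-1}\left[(Xw)X+(Yw)Y\right],\qquad \tau=|\nabla_{XY}w|^{-1}\left[(Yw)X-(Xw)Y\right],$$ and $H_{ess}w=\begin{bmatrix} XXw & YXw\\ XYw & YYw\end{bmatrix}$.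
   Context: For a function $v$, $\nabla_{XY}v:=(Xv)X+(Yv)Y$ and $|\nabla_{XY}v|=\sqrt{(Xv)^2+(Yv)^2}$. Horizontal fields $\zeta=\zeta_1X+\zeta_2Y$ are identified with their coefficient pairs $(\zeta_1,\zeta_2)$; $\operatorname{div}_{XY}(\zeta):=X\zeta_1+Y\zeta_2$ and $\langle\zeta,\theta\rangle_{XY}:=\zeta_1\theta_1+\zeta_2\theta_2$. The matrix $H_{ess}w$ (horizontal intrinsic Hessian, in general not symmetric) acts on the coefficient column vector of $\tau$. Second derivatives such as $XYw$ mean $X(Yw)$. The field $\eta$ is the intrinsic normal and $\tau$ the intrinsic tangent direction to the level sets of $w$, and $\mathcal A$ is the intrinsic curvature of the level sets. *)

theory Defs
  imports "HOL-Analysis.Analysis"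
begin

section \<open>Functions of class \<open>C\<^sup>k\<close> on open subsets of a Euclidean space\<close>

text \<open>Only meant for open \<open>S\<close>. Class \<open>C\<^sup>k\<^sup>+\<^sup>1\<close>: differentiable, with all directional derivatives
  of class \<open>C\<^sup>k\<close>; in finite dimension this is the usual notion.\<close>

primrec Ck_on :: "nat \<Rightarrow> ('a::euclidean_space \<Rightarrow> 'b::real_normed_vector) \<Rightarrow> 'a set \<Rightarrow> bool" where
  "Ck_on 0 f S \<longleftrightarrow> continuous_on S f"
| "Ck_on (Suc k) f S \<longleftrightarrow>
     f differentiable_on S \<and> (\<forall>v. Ck_on k (\<lambda>x. frechet_derivative f (at x) v) S)"

definition smooth_on :: "('a::euclidean_space \<Rightarrow> 'b::real_normed_vector) \<Rightarrow> 'a set \<Rightarrow> bool" where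
  "smooth_on f S \<longleftrightarrow> (\<forall>k. Ck_on k f S)"


section \<open>Smooth manifolds\<close>

text \<open>The manifold is a whole type \<open>'m\<close>, Hausdorff and second countable, with model space \<open>'e\<close>.
  A chart is its domain together with the coordinate map, which is only relevant on the domain.\<close>

type_synonym ('m, 'e) chart = "'m set \<times> ('m \<Rightarrow> 'e)"

abbreviation (input) dom_of :: "('m, 'e) chart \<Rightarrow> 'm set" where "dom_of \<equiv> fst"

abbreviation (input) coord :: "('m, 'e) chart \<Rightarrow> 'm \<Rightarrow> 'e" where "coord \<equiv> snd"

definition chart_inv :: "('m, 'e) chart \<Rightarrow> 'e \<Rightarrow> 'm" where
  "chart_inv c = inv_into (dom_of c) (coord c)"

definition smooth_atlas ::
  "('m::{t2_space,second_countable_topology}, 'e::euclidean_space) chart set \<Rightarrow> bool" where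
  "smooth_atlas \<A> \<longleftrightarrow>
     (\<Union>c\<in>\<A>. dom_of c) = UNIV \<and>
     (\<forall>c\<in>\<A>. open (dom_of c) \<and> open (coord c ` dom_of c) \<and>
        homeomorphism (dom_of c) (coord c ` dom_of c) (coord c) (chart_inv c)) \<and>
     (\<forall>c\<in>\<A>. \<forall>d\<in>\<A>. smooth_on (coord d \<circ> chart_inv c) (coord c ` (dom_of c \<inter> dom_of d)))"

definition C2_fun :: "('m, 'e::euclidean_space) chart set \<Rightarrow> 'm set \<Rightarrow> ('m \<Rightarrow> real) \<Rightarrow> bool" where
  "C2_fun \<A> \<Omega> w \<longleftrightarrow> (\<forall>c\<in>\<A>. Ck_on 2 (w \<circ> chart_inv c) (coord c ` (dom_of c \<inter> \<Omega>)))"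

text \<open>Lebesgue null sets are invariant under smooth changes of coordinates, so "almost everywhere"
  makes sense without a choice of measure; it agrees with the notion for any smooth volume.\<close>

definition null_on_manifold :: "('m, 'e::euclidean_space) chart set \<Rightarrow> 'm set \<Rightarrow> bool" where
  "null_on_manifold \<A> N \<longleftrightarrow> (\<forall>c\<in>\<A>. negligible (coord c ` (N \<inter> dom_of c)))"


section \<open>Vector fields\<close>

text \<open>\<open>V c p\<close> is the coordinate vector of \<open>V\<close> at \<open>p\<close> with respect to the chart \<open>c\<close>;
  it is only relevant for \<open>c\<close> in the atlas and \<open>p\<close> in the domain of \<open>c\<close>.\<close>

type_synonym ('m, 'e) vfield = "('m, 'e) chart \<Rightarrow> 'm \<Rightarrow> 'e"

definition smooth_vector_field ::
  "('m, 'e::euclidean_space) chart set \<Rightarrow> 'm set \<Rightarrow> ('m, 'e) vfield \<Rightarrow> bool" where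
  "smooth_vector_field \<A> \<Omega> V \<longleftrightarrow>
     (\<forall>c\<in>\<A>. smooth_on (V c \<circ> chart_inv c) (coord c ` (dom_of c \<inter> \<Omega>))) \<and>
     (\<forall>c\<in>\<A>. \<forall>d\<in>\<A>. \<forall>p\<in>dom_of c \<inter> dom_of d \<inter> \<Omega>.
        V d p = frechet_derivative (coord d \<circ> chart_inv c) (at (coord c p)) (V c p))"

definition chart_at :: "('m, 'e) chart set \<Rightarrow> 'm \<Rightarrow> ('m, 'e) chart" where
  "chart_at \<A> p = (SOME c. c \<in> \<A> \<and> p \<in> dom_of c)"

text \<open>The derivative \<open>V f\<close>, for \<open>f\<close> with values in any normed space. Where \<open>f\<close> is differentiable,
  it does not depend on the chosen chart; elsewhere its value is unspecified.\<close>

definition vf_deriv ::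
  "('m, 'e::euclidean_space) chart set \<Rightarrow> ('m, 'e) vfield \<Rightarrow> ('m \<Rightarrow> 'b::real_normed_vector) \<Rightarrow> 'm \<Rightarrow> 'b"
where
  "vf_deriv \<A> V f p =
     (let c = chart_at \<A> p in frechet_derivative (f \<circ> chart_inv c) (at (coord c p)) (V c p))"

text \<open>\<open>[V, W] = V W - W V\<close>. Since \<open>W c\<close> is \<open>W\<close> applied to the coordinate map of \<open>c\<close>, this is the
  usual coordinate formula for the components of the commutator.\<close>

definition lie_bracket ::
  "('m, 'e::euclidean_space) chart set \<Rightarrow> ('m, 'e) vfield \<Rightarrow> ('m, 'e) vfield \<Rightarrow> ('m, 'e) vfield" where
  "lie_bracket \<A> V W = (\<lambda>c p. vf_deriv \<A> V (W c) p - vf_deriv \<A> W (V c) p)"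


section \<open>Sub-Riemannian structures\<close>

inductive_set iterated_brackets ::
  "('m, 'e::euclidean_space) chart set \<Rightarrow> ('m, 'e) vfield set \<Rightarrow> ('m, 'e) vfield set"
  for \<A> :: "('m, 'e) chart set" and \<F> :: "('m, 'e) vfield set" where
  "V \<in> \<F> \<Longrightarrow> V \<in> iterated_brackets \<A> \<F>"
| "V \<in> iterated_brackets \<A> \<F> \<Longrightarrow> W \<in> iterated_brackets \<A> \<F> \<Longrightarrow>
     lie_bracket \<A> V W \<in> iterated_brackets \<A> \<F>"

definition inner_product_on :: "'e::real_vector set \<Rightarrow> ('e \<Rightarrow> 'e \<Rightarrow> real) \<Rightarrow> bool" where
  "inner_product_on V b \<longleftrightarrow>
     (\<forall>u\<in>V. \<forall>v\<in>V. b u v = b v u) \<and>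
     (\<forall>u\<in>V. \<forall>v\<in>V. \<forall>x\<in>V. b (u + v) x = b u x + b v x) \<and>
     (\<forall>r. \<forall>u\<in>V. \<forall>v\<in>V. b (r *\<^sub>R u) v = r * b u v) \<and>
     (\<forall>u\<in>V. u \<noteq> 0 \<longrightarrow> b u u > 0)"

text \<open>A sub-Riemannian structure is a horizontal distribution \<open>\<Delta>\<close> with a metric \<open>g\<close> on it, given in
  charts. Locally there is a finite smooth generating family \<open>F 0, \<dots>, F (m - 1)\<close> that spans \<open>\<Delta>\<close>,
  satisfies Hoermander's bracket condition, and makes \<open>g\<close> the induced metric, i.e. the squared
  length of a horizontal vector is the least \<open>\<Sum>u\<^sub>i\<^sup>2\<close> over its representations \<open>\<Sum>u\<^sub>i F\<^sub>i\<close>.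
  For linearly independent \<open>F\<close> this says that \<open>F\<close> is an orthonormal frame; admitting dependent
  families allows the rank of \<open>\<Delta>\<close> to vary, as in the Grushin plane. The behaviour of \<open>\<Delta>\<close> and \<open>g\<close>
  under a change of charts is determined by that of the \<open>F i\<close>.\<close>

definition sub_riemannian ::
  "('m::topological_space, 'e::euclidean_space) chart set \<Rightarrow>
   (('m, 'e) chart \<Rightarrow> 'm \<Rightarrow> 'e set) \<Rightarrow> (('m, 'e) chart \<Rightarrow> 'm \<Rightarrow> 'e \<Rightarrow> 'e \<Rightarrow> real) \<Rightarrow> bool" where
  "sub_riemannian \<A> \<Delta> g \<longleftrightarrow>
     (\<forall>p. \<exists>U (m::nat) F. open U \<and> p \<in> U \<and>
        (\<forall>i<m. smooth_vector_field \<A> U (F i)) \<and>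
        (\<forall>c\<in>\<A>. \<forall>q\<in>U \<inter> dom_of c.
           \<Delta> c q = span ((\<lambda>i. F i c q) ` {..<m}) \<and>
           inner_product_on (\<Delta> c q) (g c q) \<and>
           (\<forall>v\<in>\<Delta> c q.
              (\<exists>u::nat \<Rightarrow> real. v = (\<Sum>i<m. u i *\<^sub>R F i c q) \<and> g c q v v = (\<Sum>i<m. (u i)\<^sup>2)) \<and>
              (\<forall>u::nat \<Rightarrow> real. v = (\<Sum>i<m. u i *\<^sub>R F i c q) \<longrightarrow> g c q v v \<le> (\<Sum>i<m. (u i)\<^sup>2))) \<and>
           span ((\<lambda>V. V c q) ` iterated_brackets \<A> (F ` {..<m})) = UNIV))"


section \<open>Intrinsic differential operators along \<open>X\<close> and \<open>Y\<close>\<close>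

text \<open>A field \<open>\<zeta>\<^sub>1 X + \<zeta>\<^sub>2 Y\<close> is represented by its coefficient column \<open>(\<zeta>\<^sub>1, \<zeta>\<^sub>2)\<close> in \<open>real^2\<close>,
  whose standard inner product and norm are the ones written with subscript \<open>XY\<close> in the literature.\<close>

definition grad_XY ::
  "('m, 'e::euclidean_space) chart set \<Rightarrow> ('m, 'e) vfield \<Rightarrow> ('m, 'e) vfield \<Rightarrow> ('m \<Rightarrow> real) \<Rightarrow> 'm \<Rightarrow> real^2"
where
  "grad_XY \<A> X Y v p = vector [vf_deriv \<A> X v p, vf_deriv \<A> Y v p]"

definition div_XY ::
  "('m, 'e::euclidean_space) chart set \<Rightarrow> ('m, 'e) vfield \<Rightarrow> ('m, 'e) vfield \<Rightarrow> ('m \<Rightarrow> real^2) \<Rightarrow> 'm \<Rightarrow> real"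
where
  "div_XY \<A> X Y \<zeta> p = vf_deriv \<A> X (\<lambda>q. \<zeta> q $ 1) p + vf_deriv \<A> Y (\<lambda>q. \<zeta> q $ 2) p"

definition eta_XY ::
  "('m, 'e::euclidean_space) chart set \<Rightarrow> ('m, 'e) vfield \<Rightarrow> ('m, 'e) vfield \<Rightarrow> ('m \<Rightarrow> real) \<Rightarrow> 'm \<Rightarrow> real^2"
where
  "eta_XY \<A> X Y w p =
     inverse (norm (grad_XY \<A> X Y w p)) *\<^sub>R vector [vf_deriv \<A> X w p, vf_deriv \<A> Y w p]"

definition tau_XY ::
  "('m, 'e::euclidean_space) chart set \<Rightarrow> ('m, 'e) vfield \<Rightarrow> ('m, 'e) vfield \<Rightarrow> ('m \<Rightarrow> real) \<Rightarrow> 'm \<Rightarrow> real^2"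
where
  "tau_XY \<A> X Y w p =
     inverse (norm (grad_XY \<A> X Y w p)) *\<^sub>R vector [vf_deriv \<A> Y w p, - vf_deriv \<A> X w p]"

definition H_ess ::
  "('m, 'e::euclidean_space) chart set \<Rightarrow> ('m, 'e) vfield \<Rightarrow> ('m, 'e) vfield \<Rightarrow> ('m \<Rightarrow> real) \<Rightarrow> 'm \<Rightarrow> real^2^2"
where
  "H_ess \<A> X Y w p =
     vector [vector [vf_deriv \<A> X (vf_deriv \<A> X w) p, vf_deriv \<A> Y (vf_deriv \<A> X w) p],
             vector [vf_deriv \<A> X (vf_deriv \<A> Y w) p, vf_deriv \<A> Y (vf_deriv \<A> Y w) p]]"

definition curv_A ::
  "('m, 'e::euclidean_space) chart set \<Rightarrow> ('m, 'e) vfield \<Rightarrow> ('m, 'e) vfield \<Rightarrow> ('m \<Rightarrow> real) \<Rightarrow> 'm \<Rightarrow> real"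
where
  "curv_A \<A> X Y w = div_XY \<A> X Y (eta_XY \<A> X Y w)"

definition curv_B ::
  "('m, 'e::euclidean_space) chart set \<Rightarrow> ('m, 'e) vfield \<Rightarrow> ('m, 'e) vfield \<Rightarrow> ('m \<Rightarrow> real) \<Rightarrow> 'm \<Rightarrow> real"
where
  "curv_B \<A> X Y w p =
     inverse (norm (grad_XY \<A> X Y w p)) *
     (- vf_deriv \<A> (lie_bracket \<A> X Y) w p
      + (H_ess \<A> X Y w p *v tau_XY \<A> X Y w p) \<bullet> eta_XY \<A> X Y w p)"

end

theory Submission
  imports Defs
begin

text \<open>Write \<open>a = Xw\<close>, \<open>b = Yw\<close> and \<open>N = |\<nabla>\<^sub>X\<^sub>Y w|\<close>. Where \<open>N > 0\<close>, everything is a rational expression in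
  \<open>a\<close>, \<open>b\<close>, \<open>N\<close> and the four second derivatives \<open>Xa\<close>, \<open>Ya\<close>, \<open>Xb\<close>, \<open>Yb\<close>: symmetry of the second
  differential of \<open>w\<close> in a chart gives \<open>Zw = Xb - Ya\<close>, and \<open>N\<^sup>2 = a\<^sup>2 + b\<^sup>2\<close> does the rest. Where
  \<open>N = 0\<close>, both \<open>a\<close> and \<open>b\<close> vanish, and the differential of a differentiable function vanishes almost
  everywhere on its zero set. At a point where the differentials of \<open>a\<close> and \<open>b\<close> both vanish, \<open>N\<close> is
  differentiable with differential \<open>0\<close>, so that all four terms on the left are \<open>0\<close>.\<close>


section \<open>Calculus in Euclidean spaces\<close>

text \<open>Where the partial derivative along \<open>b\<close> is nonzero, replacing the coordinate along \<open>b\<close> by \<open>u\<close> has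
  injective differential, and it maps the zeros of \<open>u\<close> into a hyperplane.\<close>

lemma negligible_zeros_nonzero_derivative:
  fixes u :: "'a::euclidean_space \<Rightarrow> real"
  assumes der: "\<And>x. x \<in> S \<Longrightarrow> (u has_derivative u' x) (at x)"
  shows "negligible {x \<in> S. u x = 0 \<and> u' x \<noteq> (\<lambda>h. 0)}"
proof -
  have "negligible {x \<in> {x \<in> S. u' x b \<noteq> 0}. x + (u x - x \<bullet> b) *\<^sub>R b \<in> {y. b \<bullet> y = 0}}"
    if b: "b \<in> Basis" for b :: 'a
  proof (rule negligible_differentiable_vimage
      [where f' = "\<lambda>x h. h + (u' x h - h \<bullet> b) *\<^sub>R b"])
    show "negligible {y. b \<bullet> y = 0}"
      using b by (intro negligible_hyperplane) auto
  next
    fix x assume x: "x \<in> {x \<in> S. u' x b \<noteq> 0}"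
    then have u': "(u has_derivative u' x) (at x)" and nz: "u' x b \<noteq> 0"
      using der by auto
    show der_x: "((\<lambda>x. x + (u x - x \<bullet> b) *\<^sub>R b) has_derivative (\<lambda>h. h + (u' x h - h \<bullet> b) *\<^sub>R b))
        (at x within {x \<in> S. u' x b \<noteq> 0})"
      by (auto intro!: derivative_eq_intros has_derivative_at_withinI[OF u'])
    have lin: "linear (u' x)"
      using u' has_derivative_linear by blast
    show "inj (\<lambda>h. h + (u' x h - h \<bullet> b) *\<^sub>R b)"
    proof (subst linear_injective_0[OF has_derivative_linear[OF der_x]], intro allI impI)
      fix h assume h: "h + (u' x h - h \<bullet> b) *\<^sub>R b = 0"
      define t where "t = h \<bullet> b - u' x h"
      have ht: "h = t *\<^sub>R b"
        \<comment> \<open>A kernel vector is parallel to \<open>b\<close>; putting this back into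
          the definition of \<open>t\<close> gives \<open>t * u' x b = 0\<close>.\<close>
        using h by (simp add: t_def algebra_simps eq_neg_iff_add_eq_0)
      have "t = t - t * u' x b"
        using b lin by (subst t_def, subst (1 2) ht) (simp add: linear_cmul)
      with nz have "t = 0" by simp
      with ht show "h = 0" by simp
    qed
  qed
  then have "negligible (\<Union>b\<in>Basis. {x \<in> {x \<in> S. u' x b \<noteq> 0}. x + (u x - x \<bullet> b) *\<^sub>R b \<in> {y. b \<bullet> y = 0}})"
    by (intro negligible_Union) auto
  moreover have "{x \<in> S. u x = 0 \<and> u' x \<noteq> (\<lambda>h. 0)} \<subseteq>
      (\<Union>b\<in>Basis. {x \<in> {x \<in> S. u' x b \<noteq> 0}. x + (u x - x \<bullet> b) *\<^sub>R b \<in> {y. b \<bullet> y = 0}})"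
  proof
    fix x assume "x \<in> {x \<in> S. u x = 0 \<and> u' x \<noteq> (\<lambda>h. 0)}"
    then have x: "x \<in> S" "u x = 0" "u' x \<noteq> (\<lambda>h. 0)" by auto
    have "linear (u' x)"
      using der[OF x(1)] has_derivative_linear by blast
    then obtain b where "b \<in> Basis" "u' x b \<noteq> 0"
      using x(3) linear_eq_stdbasis[of "u' x" "\<lambda>h. 0"] linear_zero by metis
    \<comment> \<open>At a zero of \<open>u\<close> the new coordinate along \<open>b\<close> is
      \<open>x \<bullet> b + (u x - x \<bullet> b) = 0\<close>.\<close>
    with x show "x \<in> (\<Union>b\<in>Basis. {x \<in> {x \<in> S. u' x b \<noteq> 0}. x + (u x - x \<bullet> b) *\<^sub>R b \<in> {y. b \<bullet> y = 0}})"
      by (auto simp: inner_add_right inner_commute)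
  qed
  ultimately show ?thesis
    by (rule negligible_subset)
qed

section \<open>Symmetry of the second differential\<close>

text \<open>The mean value theorem along \<open>v\<close> turns the second difference into
  \<open>h\<close> times a difference of two values of \<open>\<lambda>y. f' y v\<close>, and both
  values are then expanded to first order at \<open>x\<close>.\<close>

lemma second_difference_estimate:
  fixes f :: "'a::real_normed_vector \<Rightarrow> real"
  assumes S: "open S" "x \<in> S"
    and f': "\<And>y. y \<in> S \<Longrightarrow> (f has_derivative f' y) (at y)"
    and f'': "((\<lambda>y. f' y v) has_derivative D) (at x)"
    and "e > 0"
  shows "\<exists>d>0. \<forall>h. 0 < h \<and> h < d \<longrightarrow>
    \<bar>f (x + h *\<^sub>R v + h *\<^sub>R w) - f (x + h *\<^sub>R v) - f (x + h *\<^sub>R w) + f x - h\<^sup>2 * D w\<bar> \<le> e * h\<^sup>2"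
proof -
  \<comment> \<open>All points of the parallelogram lie within \<open>h * M\<close> of
    \<open>x\<close>; the summand 1 keeps \<open>M\<close> positive if \<open>v = w = 0\<close>.
    Each of the two expansions will cost \<open>e' * (h * M) = e * h / 2\<close>.\<close>
  define M where "M = norm v + norm w + 1"
  have M: "M > 0" unfolding M_def by (simp add: add_nonneg_pos)
  define e' where "e' = e / (2 * M)"
  have e': "e' > 0" using \<open>e > 0\<close> M by (simp add: e'_def)
  obtain r where r: "r > 0" "ball x r \<subseteq> S"
    using S open_contains_ball by blast
  obtain d0 where d0: "d0 > 0"
    and approx: "\<And>y. norm (y - x) < d0 \<Longrightarrow> \<bar>f' y v - f' x v - D (y - x)\<bar> \<le> e' * norm (y - x)"
    using f'' e' unfolding has_derivative_at_alt by (metis real_norm_def)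
  \<comment> \<open>For \<open>h < d\<close> the parallelogram stays in \<open>S\<close> and within
    the range of \<open>approx\<close>.\<close>
  define d where "d = min r d0 / M"
  have d: "d > 0" using r d0 M by (simp add: d_def)
  show ?thesis
  proof (intro exI[of _ d] conjI allI impI d, elim conjE)
    fix h :: real assume h: "0 < h" "h < d"
    have hM: "h * M < min r d0"
      using h(2) M by (simp add: d_def pos_less_divide_eq)
    have near: "norm (t *\<^sub>R v + s *\<^sub>R w) \<le> h * M" if "0 \<le> t" "t \<le> h" "0 \<le> s" "s \<le> h" for t s
    proof -
      have "norm (t *\<^sub>R v + s *\<^sub>R w) \<le> t * norm v + s * norm w"
        using that norm_triangle_ineq[of "t *\<^sub>R v" "s *\<^sub>R w"] by simp
      also have "\<dots> \<le> h * norm v + h * norm w"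
        using that by (intro add_mono mult_right_mono) auto
      also have "\<dots> \<le> h * M"
        using h by (simp add: M_def algebra_simps)
      finally show ?thesis .
    qed
    have inS: "x + t *\<^sub>R v + s *\<^sub>R w \<in> S" if "0 \<le> t" "t \<le> h" "0 \<le> s" "s \<le> h" for t s
    proof -
      have "norm (x - (x + (t *\<^sub>R v + s *\<^sub>R w))) < r"
        using near[OF that] hM by (metis add_diff_cancel_left' min.strict_boundedE norm_minus_commute order_le_less_trans)
      then show ?thesis using r(2) by (auto simp: add.assoc dist_norm)
    qed
    \<comment> \<open>The first difference in direction \<open>w\<close>; the second difference is
      \<open>\<phi> h - \<phi> 0\<close>.\<close>
    define \<phi> where "\<phi> t = f (x + t *\<^sub>R v + h *\<^sub>R w) - f (x + t *\<^sub>R v)" for t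
    have der: "(\<phi> has_real_derivative (f' (x + t *\<^sub>R v + h *\<^sub>R w) v - f' (x + t *\<^sub>R v) v)) (at t)"
      if "0 \<le> t" "t \<le> h" for t
    proof -
      have a1: "(f has_derivative f' (x + t *\<^sub>R v + h *\<^sub>R w)) (at (x + t *\<^sub>R v + h *\<^sub>R w))"
        using inS[of t h] that h by (intro f') auto
      have a2: "(f has_derivative f' (x + t *\<^sub>R v)) (at (x + t *\<^sub>R v))"
        using inS[of t 0] that h by (intro f') auto
      have "(\<phi> has_derivative (\<lambda>k. f' (x + t *\<^sub>R v + h *\<^sub>R w) (k *\<^sub>R v) - f' (x + t *\<^sub>R v) (k *\<^sub>R v))) (at t)"
        unfolding \<phi>_def using a1 a2
        by (auto intro!: derivative_eq_intros
            has_derivative_compose[where g = f and g' = "f' (x + t *\<^sub>R v + h *\<^sub>R w)" and f = "\<lambda>t. x + t *\<^sub>R v + h *\<^sub>R w"]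
            has_derivative_compose[where g = f and g' = "f' (x + t *\<^sub>R v)" and f = "\<lambda>t. x + t *\<^sub>R v"])
      moreover have "linear (f' (x + t *\<^sub>R v + h *\<^sub>R w))" "linear (f' (x + t *\<^sub>R v))"
        using a1 a2 has_derivative_linear by blast+
      then have "(\<lambda>k. f' (x + t *\<^sub>R v + h *\<^sub>R w) (k *\<^sub>R v) - f' (x + t *\<^sub>R v) (k *\<^sub>R v))
          = (*) (f' (x + t *\<^sub>R v + h *\<^sub>R w) v - f' (x + t *\<^sub>R v) v)"
        by (simp add: fun_eq_iff linear_cmul algebra_simps)
      ultimately show ?thesis
        unfolding has_field_derivative_def by simp
    qed
    obtain \<xi> where \<xi>: "0 < \<xi>" "\<xi> < h"
      and mv: "\<phi> h - \<phi> 0 = (h - 0) * (f' (x + \<xi> *\<^sub>R v + h *\<^sub>R w) v - f' (x + \<xi> *\<^sub>R v) v)"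
      using MVT2[OF h(1), of \<phi> "\<lambda>t. f' (x + t *\<^sub>R v + h *\<^sub>R w) v - f' (x + t *\<^sub>R v) v"] der
      by blast
    have lin: "linear D" using f'' has_derivative_linear by blast
    define p where "p = \<xi> *\<^sub>R v + h *\<^sub>R w"
    define q where "q = \<xi> *\<^sub>R v"
    have np: "norm p \<le> h * M" unfolding p_def using near[of \<xi> h] \<xi> h by simp
    have nq: "norm q \<le> h * M" unfolding q_def using near[of \<xi> 0] \<xi> h by simp
    have 1: "\<bar>f' (x + p) v - f' x v - D p\<bar> \<le> e' * (h * M)"
      using approx[of "x + p"] np hM e' by (simp add: order_trans[OF _ mult_left_mono[OF np]])
    have 2: "\<bar>f' (x + q) v - f' x v - D q\<bar> \<le> e' * (h * M)"
      using approx[of "x + q"] nq hM e' by (simp add: order_trans[OF _ mult_left_mono[OF nq]])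
    \<comment> \<open>The unknown intermediate point \<xi> cancels, because
      \<open>p - q = h *\<^sub>R w\<close>.\<close>
    have 3: "D p - D q = h * D w"
      using lin by (simp add: p_def q_def linear_add linear_cmul)
    have "\<bar>(f' (x + p) v - f' (x + q) v) - h * D w\<bar> \<le> 2 * (e' * (h * M))"
      using 1 2 3 by linarith
    also have "\<dots> = e * h" using M by (simp add: e'_def)
    finally have 4: "\<bar>(f' (x + p) v - f' (x + q) v) - h * D w\<bar> \<le> e * h" .
    have eq: "f (x + h *\<^sub>R v + h *\<^sub>R w) - f (x + h *\<^sub>R v) - f (x + h *\<^sub>R w) + f x - h\<^sup>2 * D w
        = h * ((f' (x + p) v - f' (x + q) v) - h * D w)"
      using mv by (simp add: \<phi>_def p_def q_def power2_eq_square algebra_simps)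
    show "\<bar>f (x + h *\<^sub>R v + h *\<^sub>R w) - f (x + h *\<^sub>R v) - f (x + h *\<^sub>R w) + f x - h\<^sup>2 * D w\<bar> \<le> e * h\<^sup>2"
      unfolding eq using mult_left_mono[OF 4, of h] h by (simp add: abs_mult power2_eq_square mult_ac)
  qed
qed

text \<open>The second difference is symmetric in \<open>v\<close> and \<open>w\<close>, so
  \<open>h\<^sup>2 * Dv w\<close> and \<open>h\<^sup>2 * Dw v\<close> approximate the same number up
  to an error small compared with \<open>h\<^sup>2\<close>.\<close>

lemma symmetric_second_derivative:
  fixes f :: "'a::real_normed_vector \<Rightarrow> real"
  assumes S: "open S" "x \<in> S"
    and f': "\<And>y. y \<in> S \<Longrightarrow> (f has_derivative f' y) (at y)"
    and Dv: "((\<lambda>y. f' y v) has_derivative Dv) (at x)"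
    and Dw: "((\<lambda>y. f' y w) has_derivative Dw) (at x)"
  shows "Dv w = Dw v"
proof (rule ccontr)
  assume "Dv w \<noteq> Dw v"
  \<comment> \<open>With a third of the gap as tolerance, the two errors together make up two thirds
    of it, which is too little to bridge it.\<close>
  then have e: "\<bar>Dv w - Dw v\<bar> / 3 > 0" (is "?e > 0") by simp
  from second_difference_estimate[OF S f' Dv e, of w] obtain d1 where d1: "d1 > 0"
    "\<And>h. 0 < h \<Longrightarrow> h < d1 \<Longrightarrow>
    \<bar>f (x + h *\<^sub>R v + h *\<^sub>R w) - f (x + h *\<^sub>R v) - f (x + h *\<^sub>R w) + f x - h\<^sup>2 * Dv w\<bar> \<le> ?e * h\<^sup>2"
    by blast
  from second_difference_estimate[OF S f' Dw e, of v] obtain d2 where d2: "d2 > 0"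
    "\<And>h. 0 < h \<Longrightarrow> h < d2 \<Longrightarrow>
    \<bar>f (x + h *\<^sub>R w + h *\<^sub>R v) - f (x + h *\<^sub>R w) - f (x + h *\<^sub>R v) + f x - h\<^sup>2 * Dw v\<bar> \<le> ?e * h\<^sup>2"
    by blast
  define h where "h = min d1 d2 / 2"
  have h: "0 < h" "h < d1" "h < d2" using d1(1) d2(1) by (auto simp: h_def)
  have "\<bar>h\<^sup>2 * Dv w - h\<^sup>2 * Dw v\<bar> \<le> 2 * (?e * h\<^sup>2)"
    using d1(2)[OF h(1,2)] d2(2)[OF h(1,3)]
    by (simp only: add.assoc add.commute[of "h *\<^sub>R w"])
  moreover have "\<bar>h\<^sup>2 * Dv w - h\<^sup>2 * Dw v\<bar> = 3 * (?e * h\<^sup>2)"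
    by (simp add: abs_mult flip: right_diff_distrib)
  moreover have "?e * h\<^sup>2 > 0" using e h by simp
  ultimately show False by linarith
qed

section \<open>Differentiating a derivative along a variable field\<close>

text \<open>A product rule: \<open>V y\<close> is split into the fixed vector \<open>V x\<close>,
  which contributes \<open>f'' (V x)\<close>, and the increment \<open>V y - V x\<close>, which
  contributes \<open>f' x (V' h)\<close>.\<close>

lemma has_derivative_along_field:
  fixes f :: "'a::euclidean_space \<Rightarrow> real" and V :: "'a \<Rightarrow> 'a"
  assumes S: "open S" "x \<in> S"
    and f': "\<And>y. y \<in> S \<Longrightarrow> (f has_derivative f' y) (at y)"
    and f'': "\<And>v. ((\<lambda>y. f' y v) has_derivative f'' v) (at x)"
    and V: "(V has_derivative V') (at x)"
  shows "((\<lambda>y. f' y (V y)) has_derivative (\<lambda>h. f' x (V' h) + f'' (V x) h)) (at x)"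
proof -
  have lin: "linear (f' y)" if "y \<in> S" for y
    using f'[OF that] has_derivative_linear by blast
  have expand: "f' y v = (\<Sum>i\<in>Basis. (v \<bullet> i) * f' y i)" if "y \<in> S" for y v
    by (subst euclidean_representation[of v, symmetric])
      (simp only: linear_sum[OF lin[OF that]] linear_cmul[OF lin[OF that]] real_scaleR_def)
  have "((\<lambda>y. (\<Sum>i\<in>Basis. ((V y - V x) \<bullet> i) * f' y i)) has_derivative
      (\<lambda>h. \<Sum>i\<in>Basis. (V' h \<bullet> i) * f' x i)) (at x)"
    \<comment> \<open>The factors \<open>(V y - V x) \<bullet> i\<close> vanish at \<open>x\<close>,
      so the second derivatives of \<open>f\<close> drop out of this sum.\<close>
    by (rule derivative_eq_intros refl V f'' | simp add: algebra_simps)+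
  then have "((\<lambda>y. f' y (V x) + (\<Sum>i\<in>Basis. ((V y - V x) \<bullet> i) * f' y i)) has_derivative
      (\<lambda>h. f'' (V x) h + (\<Sum>i\<in>Basis. (V' h \<bullet> i) * f' x i))) (at x)"
    by (intro has_derivative_add f'')
  then have "((\<lambda>y. f' y (V x) + (\<Sum>i\<in>Basis. ((V y - V x) \<bullet> i) * f' y i)) has_derivative
      (\<lambda>h. f' x (V' h) + f'' (V x) h)) (at x)"
    unfolding expand[OF S(2), symmetric] by (subst add.commute)
  then show ?thesis
  proof (rule has_derivative_transform_within_open[OF _ S])
    fix y assume y: "y \<in> S"
    show "f' y (V x) + (\<Sum>i\<in>Basis. ((V y - V x) \<bullet> i) * f' y i) = f' y (V y)"
      unfolding expand[OF y, of "V y - V x", symmetric] using lin[OF y] by (simp add: linear_diff)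
  qed
qed

section \<open>The Euclidean norm of a pair of functions, and the algebra of its derivatives\<close>

lemma has_derivative_sqrt_sum_squares:
  fixes a b :: "'a::real_normed_vector \<Rightarrow> real"
  assumes a: "(a has_derivative a') (at x)" and b: "(b has_derivative b') (at x)"
    and pos: "sqrt ((a x)\<^sup>2 + (b x)\<^sup>2) > 0"
  shows "((\<lambda>y. sqrt ((a y)\<^sup>2 + (b y)\<^sup>2)) has_derivative
    (\<lambda>h. (a x * a' h + b x * b' h) / sqrt ((a x)\<^sup>2 + (b x)\<^sup>2))) (at x)"
  using pos
  by (auto intro!: derivative_eq_intros a b simp: fun_eq_iff divide_simps)

text \<open>The chain rule fails since the square root is not differentiable at 0. Instead, the norm
  is at most \<open>\<bar>a y\<bar> + \<bar>b y\<bar>\<close>, and both summands are of smaller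
  order than \<open>norm (y - x)\<close>.\<close>

lemma has_derivative_sqrt_sum_squares_zero:
  fixes a b :: "'a::real_normed_vector \<Rightarrow> real"
  assumes a: "(a has_derivative (\<lambda>h. 0)) (at x)" and b: "(b has_derivative (\<lambda>h. 0)) (at x)"
    and zero: "a x = 0" "b x = 0"
  shows "((\<lambda>y. sqrt ((a y)\<^sup>2 + (b y)\<^sup>2)) has_derivative (\<lambda>h. 0)) (at x)"
  unfolding has_derivative_at_alt
proof (intro conjI allI impI)
  show "bounded_linear (\<lambda>h::'a. 0::real)" by simp
  fix e :: real assume "e > 0"
  then have e: "e / 2 > 0" by simp
  obtain d1 where d1: "d1 > 0" "\<And>y. norm (y - x) < d1 \<Longrightarrow> \<bar>a y\<bar> \<le> e / 2 * norm (y - x)"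
    using a e zero unfolding has_derivative_at_alt by fastforce
  obtain d2 where d2: "d2 > 0" "\<And>y. norm (y - x) < d2 \<Longrightarrow> \<bar>b y\<bar> \<le> e / 2 * norm (y - x)"
    using b e zero unfolding has_derivative_at_alt by fastforce
  show "\<exists>d>0. \<forall>y. norm (y - x) < d \<longrightarrow>
      norm (sqrt ((a y)\<^sup>2 + (b y)\<^sup>2) - sqrt ((a x)\<^sup>2 + (b x)\<^sup>2) - 0) \<le> e * norm (y - x)"
  proof (intro exI[of _ "min d1 d2"] conjI allI impI)
    fix y assume "norm (y - x) < min d1 d2"
    then have "\<bar>a y\<bar> + \<bar>b y\<bar> \<le> e * norm (y - x)"
      using d1(2)[of y] d2(2)[of y] by (simp add: field_simps)
    then show "norm (sqrt ((a y)\<^sup>2 + (b y)\<^sup>2) - sqrt ((a x)\<^sup>2 + (b x)\<^sup>2) - 0) \<le> e * norm (y - x)"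
      using sqrt_sum_squares_le_sum_abs[of "a y" "b y"] zero by simp
  qed (use d1 d2 in simp)
qed

text \<open>Both components of \<open>eta_XY\<close> have the form \<open>inverse N * a\<close>; the
  quotient is written as it occurs in \<open>curvature_identity\<close>.\<close>

lemma has_derivative_normalized:
  fixes a b N :: "'a::real_normed_vector \<Rightarrow> real"
  assumes a: "(a has_derivative a') (at x)" and N: "(N has_derivative N') (at x)"
    and pos: "N x > 0"
  shows "((\<lambda>y. inverse (N y) * a y) has_derivative (\<lambda>h. (a' h * N x - a x * N' h) / (N x)\<^sup>2)) (at x)"
  using pos
  by (auto intro!: derivative_eq_intros a N simp: field_simps power2_eq_square)

text \<open>With \<open>P = b Xa - a Xb\<close> and \<open>Q = b Ya - a Yb\<close>, the left-hand side is \<open>(P\<^sup>2 + Q\<^sup>2) / N\<^sup>2\<close>, while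
  \<open>\<A> = (b P - a Q) / N\<^sup>3\<close> and \<open>\<B> = (a P + b Q) / N\<^sup>3\<close>.\<close>

lemma curvature_identity:
  fixes a b N Xa Xb Ya Yb :: real
  assumes N: "N > 0" and N2: "N\<^sup>2 = a\<^sup>2 + b\<^sup>2"
  defines "XN \<equiv> (a * Xa + b * Xb) / N" and "YN \<equiv> (a * Ya + b * Yb) / N"
  shows "Xa\<^sup>2 + Ya\<^sup>2 + (Xb\<^sup>2 + Yb\<^sup>2) - XN\<^sup>2 - YN\<^sup>2 =
    N\<^sup>2 * (((Xa * N - a * XN) / N\<^sup>2 + (Yb * N - b * YN) / N\<^sup>2)\<^sup>2
      + (inverse N * (- (Xb - Ya) +
          ((Xa * (b / N) + Ya * (- a / N)) * (a / N) + (Xb * (b / N) + Yb * (- a / N)) * (b / N))))\<^sup>2)"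
proof -
  define P where "P = b * Xa - a * Xb"
  define Q where "Q = b * Ya - a * Yb"
  have lhs: "Xa\<^sup>2 + Ya\<^sup>2 + (Xb\<^sup>2 + Yb\<^sup>2) - XN\<^sup>2 - YN\<^sup>2 = (P\<^sup>2 + Q\<^sup>2) / N\<^sup>2"
  proof -
    have "N\<^sup>2 * XN\<^sup>2 = (a * Xa + b * Xb)\<^sup>2" "N\<^sup>2 * YN\<^sup>2 = (a * Ya + b * Yb)\<^sup>2"
      using N by (simp_all add: XN_def YN_def power_divide)
    then have "(Xa\<^sup>2 + Ya\<^sup>2 + (Xb\<^sup>2 + Yb\<^sup>2) - XN\<^sup>2 - YN\<^sup>2) * N\<^sup>2 =
        (Xa\<^sup>2 + Ya\<^sup>2 + (Xb\<^sup>2 + Yb\<^sup>2)) * N\<^sup>2 - (a * Xa + b * Xb)\<^sup>2 - (a * Ya + b * Yb)\<^sup>2"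
      by (simp add: algebra_simps)
    \<comment> \<open>Lagrange's identity in the plane, once for \<open>(Xa, Xb)\<close> and once
      for \<open>(Ya, Yb)\<close>, each paired with \<open>(a, b)\<close>.\<close>
    also have "\<dots> = P\<^sup>2 + Q\<^sup>2"
      unfolding N2 P_def Q_def by (simp add: power2_eq_square algebra_simps)
    finally show ?thesis using N by (simp add: eq_divide_eq)
  qed
  have A: "(Xa * N - a * XN) / N\<^sup>2 + (Yb * N - b * YN) / N\<^sup>2 = (b * P - a * Q) / N ^ 3"
  proof -
    have XN: "N * XN = a * Xa + b * Xb" and YN: "N * YN = a * Ya + b * Yb"
      using N by (simp_all add: XN_def YN_def)
    \<comment> \<open>The extra factor \<open>N\<close> makes \<open>XN\<close> and
      \<open>YN\<close> appear only as \<open>N * XN\<close> and \<open>N * YN\<close>, which are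
      polynomials.\<close>
    have "(Xa * N - a * XN + (Yb * N - b * YN)) * N
        = (Xa + Yb) * N\<^sup>2 - a * (N * XN) - b * (N * YN)"
      by (simp add: power2_eq_square algebra_simps)
    also have "\<dots> = b * P - a * Q"
      unfolding N2 XN YN P_def Q_def by (simp add: power2_eq_square algebra_simps)
    finally have "(b * P - a * Q) / N ^ 3 = (Xa * N - a * XN + (Yb * N - b * YN)) * N / (N\<^sup>2 * N)"
      by (simp add: power2_eq_square power3_eq_cube)
    then show ?thesis
      using N by (simp add: add_divide_distrib)
  qed
  \<comment> \<open>\<open>E\<close> is \<open>-Zw\<close> plus the Hessian term, with \<tau> =
    \<open>(b / N, - a / N)\<close> and \<eta> = \<open>(a / N, b / N)\<close>.\<close>
  define E where "E = - (Xb - Ya) +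
      ((Xa * (b / N) + Ya * (- a / N)) * (a / N) + (Xb * (b / N) + Yb * (- a / N)) * (b / N))"
  have B: "inverse N * E = (a * P + b * Q) / N ^ 3"
  proof -
    have "E * N\<^sup>2 = - (Xb - Ya) * N\<^sup>2 + ((Xa * b - Ya * a) * a + (Xb * b - Yb * a) * b)"
      using N by (simp add: E_def field_simps power2_eq_square)
    also have "\<dots> = a * P + b * Q"
      unfolding N2 P_def Q_def by (simp add: power2_eq_square algebra_simps)
    finally have E: "a * P + b * Q = E * N\<^sup>2" ..
    have "N ^ 3 = N * N\<^sup>2" by (simp add: power2_eq_square power3_eq_cube)
    then show ?thesis
      unfolding E using N by (simp add: field_simps)
  qed
  \<comment> \<open>The map \<open>(P, Q)\<close> to \<open>(b * P - a * Q, a * P + b * Q)\<close>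
    is a rotation scaled by \<open>N\<close>.\<close>
  have "(b * P - a * Q)\<^sup>2 + (a * P + b * Q)\<^sup>2 = N\<^sup>2 * (P\<^sup>2 + Q\<^sup>2)"
    unfolding N2 by (simp add: power2_eq_square algebra_simps)
  then have "((b * P - a * Q) / N ^ 3)\<^sup>2 + ((a * P + b * Q) / N ^ 3)\<^sup>2 = N\<^sup>2 * (P\<^sup>2 + Q\<^sup>2) / (N ^ 3)\<^sup>2"
    by (simp add: power_divide flip: add_divide_distrib)
  moreover have "N\<^sup>2 * (N\<^sup>2 * (P\<^sup>2 + Q\<^sup>2) / (N ^ 3)\<^sup>2) = (P\<^sup>2 + Q\<^sup>2) / N\<^sup>2"
    using N by (simp add: divide_simps power2_eq_square power3_eq_cube)
  ultimately show ?thesis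
    unfolding lhs A E_def[symmetric] B by simp
qed


section \<open>Calculus in charts\<close>

lemma Ck_on_2D:
  assumes "Ck_on 2 f S" "open S" "x \<in> S"
  shows "(f has_derivative frechet_derivative f (at x)) (at x)"
    and "((\<lambda>y. frechet_derivative f (at y) v) has_derivative
      frechet_derivative (\<lambda>y. frechet_derivative f (at y) v) (at x)) (at x)"
  using assms
  by (auto simp: numeral_2_eq_2 differentiable_on_eq_differentiable_at simp flip: frechet_derivative_works)

lemma smooth_on_has_derivative:
  assumes "smooth_on f S" "open S" "x \<in> S"
  shows "(f has_derivative frechet_derivative f (at x)) (at x)"
proof -
  have "Ck_on (Suc 0) f S" using assms(1) unfolding smooth_on_def by blast
  then show ?thesis
    using assms(2,3) by (simp add: differentiable_on_eq_differentiable_at frechet_derivative_works)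
qed

section \<open>Charts and independence of the chart\<close>

lemma chart_at:
  assumes "smooth_atlas \<A>"
  shows "chart_at \<A> p \<in> \<A>" "p \<in> fst (chart_at \<A> p)"
proof -
  have "\<exists>c. c \<in> \<A> \<and> p \<in> fst c"
    using assms unfolding smooth_atlas_def by blast
  then have "chart_at \<A> p \<in> \<A> \<and> p \<in> fst (chart_at \<A> p)"
    unfolding chart_at_def by (rule someI_ex)
  then show "chart_at \<A> p \<in> \<A>" "p \<in> fst (chart_at \<A> p)" by auto
qed

lemma chart_inv_coord:
  assumes "smooth_atlas \<A>" "c \<in> \<A>" "p \<in> fst c"
  shows "chart_inv c (snd c p) = p"
  using assms unfolding smooth_atlas_def homeomorphism_def by blast

lemma open_chart_image:
  assumes "smooth_atlas \<A>" "c \<in> \<A>" "open U"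
  shows "open (snd c ` (fst c \<inter> U))"
proof -
  have hom: "homeomorphism (fst c) (snd c ` fst c) (snd c) (chart_inv c)"
    and op: "open (snd c ` fst c)"
    using assms unfolding smooth_atlas_def by blast+
  have "openin (top_of_set (snd c ` fst c)) (snd c ` (fst c \<inter> U))"
    by (rule homeomorphism_imp_open_map[OF hom]) (use assms(3) in blast)
  then show ?thesis using op openin_open_trans by blast
qed

text \<open>Near \<open>snd d p\<close>, the function \<open>f \<circ> chart_inv d\<close> is
  \<open>f \<circ> chart_inv c\<close> after the smooth transition map, so the chain rule
  applies.\<close>

lemma has_derivative_change_chart:
  assumes \<A>: "smooth_atlas \<A>" and c: "c \<in> \<A>" "p \<in> fst c" and d: "d \<in> \<A>" "p \<in> fst d"
    and f: "(f \<circ> chart_inv c has_derivative f') (at (snd c p))"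
  shows "(f \<circ> chart_inv d has_derivative
    (\<lambda>h. f' (frechet_derivative (snd c \<circ> chart_inv d) (at (snd d p)) h))) (at (snd d p))"
proof -
  let ?S = "snd d ` (fst d \<inter> fst c)" and ?T = "snd c \<circ> chart_inv d"
  have S: "open ?S" "snd d p \<in> ?S"
    using open_chart_image[OF \<A> d(1), of "fst c"] \<A> c d unfolding smooth_atlas_def by auto
  have "smooth_on ?T ?S"
    using \<A> c d unfolding smooth_atlas_def by blast
  then have T: "(?T has_derivative frechet_derivative ?T (at (snd d p))) (at (snd d p))"
    using S smooth_on_has_derivative by blast
  have Tp: "?T (snd d p) = snd c p"
    using chart_inv_coord[OF \<A> d] by simp
  have "((\<lambda>x. (f \<circ> chart_inv c) (?T x)) has_derivative
      (\<lambda>h. f' (frechet_derivative ?T (at (snd d p)) h))) (at (snd d p))"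
    using f by (intro has_derivative_compose[OF T]) (simp only: Tp)
  then show ?thesis
  proof (rule has_derivative_transform_within_open[OF _ S])
    fix x assume "x \<in> ?S"
    then show "(f \<circ> chart_inv c) (?T x) = (f \<circ> chart_inv d) x"
      using chart_inv_coord[OF \<A> c(1)] chart_inv_coord[OF \<A> d(1)] by auto
  qed
qed

text \<open>In the chart that \<open>vf_deriv\<close> itself selects, the value can be read off for
  an arbitrary \<open>V\<close>, in particular for \<open>lie_bracket \<A> X Y\<close>.\<close>

lemma vf_deriv_chart_at:
  assumes "(f \<circ> chart_inv (chart_at \<A> p) has_derivative f') (at (snd (chart_at \<A> p) p))"
  shows "vf_deriv \<A> V f p = f' (V (chart_at \<A> p) p)"
  using frechet_derivative_at[OF assms] by (simp add: vf_deriv_def Let_def)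

text \<open>The differential of the transition map brought in by the chain rule is the one that
  carries the components of \<open>V\<close> in the selected chart to those in
  \<open>c\<close>.\<close>

lemma vf_deriv_eq:
  assumes \<A>: "smooth_atlas \<A>" and V: "smooth_vector_field \<A> \<Omega> V" and p: "p \<in> \<Omega>"
    and c: "c \<in> \<A>" "p \<in> fst c"
    and f: "(f \<circ> chart_inv c has_derivative f') (at (snd c p))"
  shows "vf_deriv \<A> V f p = f' (V c p)"
proof -
  let ?d = "chart_at \<A> p"
  have d: "?d \<in> \<A>" "p \<in> fst ?d" using chart_at[OF \<A>] by auto
  have "vf_deriv \<A> V f p = f' (frechet_derivative (snd c \<circ> chart_inv ?d) (at (snd ?d p)) (V ?d p))"
    by (rule vf_deriv_chart_at[OF has_derivative_change_chart[OF \<A> c d f]])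
  also have "frechet_derivative (snd c \<circ> chart_inv ?d) (at (snd ?d p)) (V ?d p) = V c p"
    using V c d p unfolding smooth_vector_field_def by (metis IntI)
  finally show ?thesis .
qed

section \<open>Second derivatives along fields and the commutator\<close>

text \<open>In the coordinates of \<open>c\<close>, \<open>vf_deriv \<A> V w\<close> becomes the
  differential of \<open>w\<close> applied to the variable field \<open>V\<close>, to which
  \<open>has_derivative_along_field\<close> applies.\<close>

lemma has_derivative_vf_deriv:
  fixes w :: "'m::{t2_space,second_countable_topology} \<Rightarrow> real"
    and \<A> :: "('m, 'e::euclidean_space) chart set"
  assumes \<A>: "smooth_atlas \<A>" and \<Omega>: "open \<Omega>" and V: "smooth_vector_field \<A> \<Omega> V"
    and w: "C2_fun \<A> \<Omega> w" and c: "c \<in> \<A>" and p: "p \<in> fst c \<inter> \<Omega>"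
  defines "x \<equiv> snd c p" and "W' \<equiv> \<lambda>y. frechet_derivative (w \<circ> chart_inv c) (at y)"
  shows "(vf_deriv \<A> V w \<circ> chart_inv c has_derivative
    (\<lambda>h. W' x (frechet_derivative (V c \<circ> chart_inv c) (at x) h)
      + frechet_derivative (\<lambda>y. W' y (V c p)) (at x) h)) (at x)"
proof -
  let ?S = "snd c ` (fst c \<inter> \<Omega>)"
  have S: "open ?S" "x \<in> ?S"
    using open_chart_image[OF \<A> c \<Omega>] p by (auto simp: x_def)
  have ck: "Ck_on 2 (w \<circ> chart_inv c) ?S"
    using w c unfolding C2_fun_def by blast
  have W: "(w \<circ> chart_inv c has_derivative W' y) (at y)" if "y \<in> ?S" for y
    unfolding W'_def by (rule Ck_on_2D[OF ck S(1) that])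
  have W2: "((\<lambda>y. W' y v) has_derivative frechet_derivative (\<lambda>y. W' y v) (at x)) (at x)" for v
    unfolding W'_def by (rule Ck_on_2D[OF ck S])
  have "smooth_on (V c \<circ> chart_inv c) ?S"
    using V c unfolding smooth_vector_field_def by blast
  then have V': "(V c \<circ> chart_inv c has_derivative frechet_derivative (V c \<circ> chart_inv c) (at x)) (at x)"
    using S smooth_on_has_derivative by blast
  have Vx: "(V c \<circ> chart_inv c) x = V c p"
    using chart_inv_coord[OF \<A> c] p by (simp add: x_def)
  show ?thesis
  proof (rule has_derivative_transform_within_open
      [OF has_derivative_along_field[OF S W W2 V', unfolded Vx] S])
    \<comment> \<open>At nearby points \<open>chart_at\<close> may select other charts;
      \<open>vf_deriv_eq\<close> brings all values back to the one chart \<open>c\<close>.\<close>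
    fix y assume y: "y \<in> ?S"
    then obtain q where q: "q \<in> fst c" "q \<in> \<Omega>" "y = snd c q" by blast
    then show "W' y ((V c \<circ> chart_inv c) y) = (vf_deriv \<A> V w \<circ> chart_inv c) y"
      using vf_deriv_eq[OF \<A> V q(2) c q(1) W[OF y, unfolded q(3)]] chart_inv_coord[OF \<A> c q(1)]
      by simp
  qed
qed

text \<open>Both iterated derivatives consist of a second differential of \<open>w\<close> and a
  first differential applied to a derivative of field components. The second differentials cancel by
  symmetry; what remains is the differential of \<open>w\<close> on the components of the
  bracket.\<close>

lemma vf_deriv_lie_bracket:
  fixes w :: "'m::{t2_space,second_countable_topology} \<Rightarrow> real"
    and \<A> :: "('m, 'e::euclidean_space) chart set"
  assumes \<A>: "smooth_atlas \<A>" and \<Omega>: "open \<Omega>" and X: "smooth_vector_field \<A> \<Omega> X"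
    and Y: "smooth_vector_field \<A> \<Omega> Y" and w: "C2_fun \<A> \<Omega> w" and p: "p \<in> \<Omega>"
  shows "vf_deriv \<A> (lie_bracket \<A> X Y) w p
    = vf_deriv \<A> X (vf_deriv \<A> Y w) p - vf_deriv \<A> Y (vf_deriv \<A> X w) p"
proof -
  \<comment> \<open>With this choice, \<open>lie_bracket\<close> and \<open>vf_deriv\<close> unfold
    at \<open>p\<close> directly in the chart \<open>c\<close>.\<close>
  define c where "c = chart_at \<A> p"
  define x where "x = snd c p"
  define W' where "W' y = frechet_derivative (w \<circ> chart_inv c) (at y)" for y
  define X' where "X' = frechet_derivative (X c \<circ> chart_inv c) (at x)"
  define Y' where "Y' = frechet_derivative (Y c \<circ> chart_inv c) (at x)"
  have c: "c \<in> \<A>" "p \<in> fst c" using chart_at[OF \<A>] by (auto simp: c_def)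
  then have pc: "p \<in> fst c \<inter> \<Omega>" using p by blast
  let ?S = "snd c ` (fst c \<inter> \<Omega>)"
  have S: "open ?S" "x \<in> ?S"
    using open_chart_image[OF \<A> c(1) \<Omega>] pc by (auto simp: x_def)
  have ck: "Ck_on 2 (w \<circ> chart_inv c) ?S"
    using w c unfolding C2_fun_def by blast
  have W: "(w \<circ> chart_inv c has_derivative W' y) (at y)" if "y \<in> ?S" for y
    unfolding W'_def by (rule Ck_on_2D[OF ck S(1) that])
  have W2: "((\<lambda>y. W' y v) has_derivative frechet_derivative (\<lambda>y. W' y v) (at x)) (at x)" for v
    unfolding W'_def by (rule Ck_on_2D[OF ck S])
  have sym: "frechet_derivative (\<lambda>y. W' y (Y c p)) (at x) (X c p)
      = frechet_derivative (\<lambda>y. W' y (X c p)) (at x) (Y c p)"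
    by (rule symmetric_second_derivative[OF S W W2 W2])
  have XY: "vf_deriv \<A> X (vf_deriv \<A> Y w) p
      = W' x (Y' (X c p)) + frechet_derivative (\<lambda>y. W' y (Y c p)) (at x) (X c p)"
    unfolding W'_def x_def Y'_def
    by (rule vf_deriv_eq[OF \<A> X p c has_derivative_vf_deriv[OF \<A> \<Omega> Y w c(1) pc]])
  have YX: "vf_deriv \<A> Y (vf_deriv \<A> X w) p
      = W' x (X' (Y c p)) + frechet_derivative (\<lambda>y. W' y (X c p)) (at x) (Y c p)"
    unfolding W'_def x_def X'_def
    by (rule vf_deriv_eq[OF \<A> Y p c has_derivative_vf_deriv[OF \<A> \<Omega> X w c(1) pc]])
  have "lie_bracket \<A> X Y c p = Y' (X c p) - X' (Y c p)"
    by (simp add: lie_bracket_def vf_deriv_def X'_def Y'_def x_def Let_def flip: c_def)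
  moreover have "vf_deriv \<A> (lie_bracket \<A> X Y) w p = W' x (lie_bracket \<A> X Y c p)"
    using vf_deriv_chart_at[of w \<A> p "W' x"] W[OF S(2)] by (simp add: x_def flip: c_def)
  moreover have "linear (W' x)"
    using W[OF S(2)] has_derivative_linear by blast
  ultimately show ?thesis
    using XY YX sym by (simp add: linear_diff)
qed

section \<open>The identity where the gradient does not vanish\<close>

lemma norm_grad_XY:
  "norm (grad_XY \<A> X Y v p) = sqrt ((vf_deriv \<A> X v p)\<^sup>2 + (vf_deriv \<A> Y v p)\<^sup>2)"
  by (simp add: grad_XY_def norm_vec_def L2_set_def sum_2)

lemma power2_norm_grad_XY:
  "(norm (grad_XY \<A> X Y v p))\<^sup>2 = (vf_deriv \<A> X v p)\<^sup>2 + (vf_deriv \<A> Y v p)\<^sup>2"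
  by (simp add: norm_grad_XY)

text \<open>Evaluating the differentials of \<open>Xw\<close>, \<open>Yw\<close> and the norm in one
  chart, on the components of \<open>X\<close> and \<open>Y\<close>, turns the claim into
  \<open>curvature_identity\<close>.\<close>

lemma curvature_identity_at:
  fixes w :: "'m::{t2_space,second_countable_topology} \<Rightarrow> real"
    and \<A> :: "('m, 'e::euclidean_space) chart set"
  assumes \<A>: "smooth_atlas \<A>" and \<Omega>: "open \<Omega>" and X: "smooth_vector_field \<A> \<Omega> X"
    and Y: "smooth_vector_field \<A> \<Omega> Y" and w: "C2_fun \<A> \<Omega> w" and p: "p \<in> \<Omega>"
    and pos: "norm (grad_XY \<A> X Y w p) > 0"
  shows "(norm (grad_XY \<A> X Y (vf_deriv \<A> X w) p))\<^sup>2 + (norm (grad_XY \<A> X Y (vf_deriv \<A> Y w) p))\<^sup>2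
      - \<bar>vf_deriv \<A> X (\<lambda>q. norm (grad_XY \<A> X Y w q)) p\<bar>\<^sup>2
      - \<bar>vf_deriv \<A> Y (\<lambda>q. norm (grad_XY \<A> X Y w q)) p\<bar>\<^sup>2
    = (norm (grad_XY \<A> X Y w p))\<^sup>2 * ((curv_A \<A> X Y w p)\<^sup>2 + (curv_B \<A> X Y w p)\<^sup>2)"
proof -
  define c where "c = chart_at \<A> p"
  define x where "x = snd c p"
  define u where "u = vf_deriv \<A> X w"
  define v where "v = vf_deriv \<A> Y w"
  define N where "N q = norm (grad_XY \<A> X Y w q)" for q
  have c: "c \<in> \<A>" "p \<in> fst c" using chart_at[OF \<A>] by (auto simp: c_def)
  then have pc: "p \<in> fst c \<inter> \<Omega>" using p by blast
  have px: "chart_inv c x = p" using chart_inv_coord[OF \<A> c] by (simp add: x_def)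
  have Np: "N p > 0" using pos by (simp add: N_def)
  have Nsqrt: "N q = sqrt ((u q)\<^sup>2 + (v q)\<^sup>2)" for q
    by (simp add: N_def norm_grad_XY u_def v_def)
  obtain u' where u': "(u \<circ> chart_inv c has_derivative u') (at x)"
    unfolding u_def x_def using has_derivative_vf_deriv[OF \<A> \<Omega> X w c(1) pc] by blast
  obtain v' where v': "(v \<circ> chart_inv c has_derivative v') (at x)"
    unfolding v_def x_def using has_derivative_vf_deriv[OF \<A> \<Omega> Y w c(1) pc] by blast
  define N' where "N' h = (u p * u' h + v p * v' h) / N p" for h
  have N': "(N \<circ> chart_inv c has_derivative N') (at x)"
    using has_derivative_sqrt_sum_squares[OF u' v'] Np
    by (simp add: Nsqrt[abs_def] N'_def[abs_def] o_def px)
  have nu: "((\<lambda>q. inverse (N q) * u q) \<circ> chart_inv c has_derivative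
      (\<lambda>h. (u' h * N p - u p * N' h) / (N p)\<^sup>2)) (at x)"
    using has_derivative_normalized[OF u' N'] Np by (simp add: o_def px)
  have nv: "((\<lambda>q. inverse (N q) * v q) \<circ> chart_inv c has_derivative
      (\<lambda>h. (v' h * N p - v p * N' h) / (N p)\<^sup>2)) (at x)"
    using has_derivative_normalized[OF v' N'] Np by (simp add: o_def px)
  have D: "vf_deriv \<A> V f p = f' (V c p)" if "(f \<circ> chart_inv c has_derivative f') (at x)"
    for V f and f' :: "'e \<Rightarrow> real"
    using vf_deriv_chart_at[of f \<A> p f' V] that by (simp add: x_def c_def)
  have A: "curv_A \<A> X Y w p = (u' (X c p) * N p - u p * N' (X c p)) / (N p)\<^sup>2
      + (v' (Y c p) * N p - v p * N' (Y c p)) / (N p)\<^sup>2"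
    using D[OF nu] D[OF nv]
    by (simp add: curv_A_def div_XY_def eta_XY_def flip: N_def u_def v_def)
  \<comment> \<open>The commutator enters as \<open>XYw - YXw\<close>; the rows of the Hessian are
    the derivatives of \<open>u = Xw\<close> and of \<open>v = Yw\<close> along \<open>X\<close> and
    \<open>Y\<close>.\<close>
  have B: "curv_B \<A> X Y w p = inverse (N p) * (- (v' (X c p) - u' (Y c p)) +
      ((u' (X c p) * (v p / N p) + u' (Y c p) * (- u p / N p)) * (u p / N p)
      + (v' (X c p) * (v p / N p) + v' (Y c p) * (- u p / N p)) * (v p / N p)))"
    using D[OF u'] D[OF v'] vf_deriv_lie_bracket[OF \<A> \<Omega> X Y w p]
    by (simp add: curv_B_def H_ess_def tau_XY_def eta_XY_def matrix_vector_mult_def inner_vec_def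
        sum_2 divide_inverse mult.commute[of "inverse (N p)"] flip: N_def u_def v_def)
  have "(N p)\<^sup>2 = (u p)\<^sup>2 + (v p)\<^sup>2" by (simp add: Nsqrt)
  then show ?thesis
    unfolding N_def[symmetric] power2_norm_grad_XY u_def[symmetric] v_def[symmetric] A B power2_abs
      D[OF u'] D[OF v'] D[OF N'] N'_def
    by (rule curvature_identity[OF Np])
qed

section \<open>The zero set of the gradient\<close>

lemma vf_deriv_norm_grad_XY_zero:
  fixes w :: "'m::{t2_space,second_countable_topology} \<Rightarrow> real"
    and \<A> :: "('m, 'e::euclidean_space) chart set"
  assumes \<A>: "smooth_atlas \<A>" and V: "smooth_vector_field \<A> \<Omega> V" and p: "p \<in> \<Omega>"
    and c: "c \<in> \<A>" "p \<in> fst c" and zero: "norm (grad_XY \<A> X Y w p) = 0"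
    and u: "(vf_deriv \<A> X w \<circ> chart_inv c has_derivative (\<lambda>h. 0)) (at (snd c p))"
    and v: "(vf_deriv \<A> Y w \<circ> chart_inv c has_derivative (\<lambda>h. 0)) (at (snd c p))"
  shows "vf_deriv \<A> V (\<lambda>q. norm (grad_XY \<A> X Y w q)) p = 0"
proof -
  have "vf_deriv \<A> X w p = 0" "vf_deriv \<A> Y w p = 0"
    using zero by (simp_all add: norm_grad_XY)
  then have "((\<lambda>q. norm (grad_XY \<A> X Y w q)) \<circ> chart_inv c has_derivative (\<lambda>h. 0)) (at (snd c p))"
    using has_derivative_sqrt_sum_squares_zero[OF u v] chart_inv_coord[OF \<A> c]
    by (simp add: norm_grad_XY o_def)
  then show ?thesis
    using vf_deriv_eq[OF \<A> V p c] by blast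
qed

text \<open>In every chart the exceptional points are covered by two null sets: the zeros of
  \<open>Xw\<close>, and those of \<open>Yw\<close>, at which the respective differential is
  nonzero.\<close>

lemma null_curvature_defect:
  fixes w :: "'m::{t2_space,second_countable_topology} \<Rightarrow> real"
    and \<A> :: "('m, 'e::euclidean_space) chart set"
  assumes \<A>: "smooth_atlas \<A>" and \<Omega>: "open \<Omega>" and X: "smooth_vector_field \<A> \<Omega> X"
    and Y: "smooth_vector_field \<A> \<Omega> Y" and w: "C2_fun \<A> \<Omega> w"
  defines "E \<equiv> \<lambda>p. (norm (grad_XY \<A> X Y (vf_deriv \<A> X w) p))\<^sup>2
      + (norm (grad_XY \<A> X Y (vf_deriv \<A> Y w) p))\<^sup>2
      - \<bar>vf_deriv \<A> X (\<lambda>q. norm (grad_XY \<A> X Y w q)) p\<bar>\<^sup>2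
      - \<bar>vf_deriv \<A> Y (\<lambda>q. norm (grad_XY \<A> X Y w q)) p\<bar>\<^sup>2"
  shows "null_on_manifold \<A> {p \<in> {p. norm (grad_XY \<A> X Y w p) = 0} \<inter> \<Omega>. E p \<noteq> 0}"
    (is "null_on_manifold \<A> ?Z")
  unfolding null_on_manifold_def
proof
  fix c assume c: "c \<in> \<A>"
  let ?S = "snd c ` (fst c \<inter> \<Omega>)"
  define bad where "bad f = {x \<in> ?S. (f \<circ> chart_inv c) x = 0 \<and>
      frechet_derivative (f \<circ> chart_inv c) (at x) \<noteq> (\<lambda>h. 0)}" for f :: "'m \<Rightarrow> real"
  have der: "(vf_deriv \<A> V w \<circ> chart_inv c has_derivative
      frechet_derivative (vf_deriv \<A> V w \<circ> chart_inv c) (at (snd c p))) (at (snd c p))"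
    if "smooth_vector_field \<A> \<Omega> V" "p \<in> fst c \<inter> \<Omega>" for V p
    unfolding frechet_derivative_works[symmetric]
    by (rule Derivative.differentiableI[OF has_derivative_vf_deriv[OF \<A> \<Omega> that(1) w c that(2)]])
  have bad: "negligible (bad (vf_deriv \<A> V w))" if "smooth_vector_field \<A> \<Omega> V" for V
    unfolding bad_def by (rule negligible_zeros_nonzero_derivative) (use der[OF that] in blast)
  have "snd c ` (?Z \<inter> fst c) \<subseteq> bad (vf_deriv \<A> X w) \<union> bad (vf_deriv \<A> Y w)"
  proof (rule image_subsetI, rule ccontr)
    fix p assume "p \<in> ?Z \<inter> fst c"
      and "snd c p \<notin> bad (vf_deriv \<A> X w) \<union> bad (vf_deriv \<A> Y w)"
    then have p: "p \<in> \<Omega>" "p \<in> fst c" and zero: "norm (grad_XY \<A> X Y w p) = 0"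
      and E: "E p \<noteq> 0"
      and good: "snd c p \<notin> bad (vf_deriv \<A> X w)" "snd c p \<notin> bad (vf_deriv \<A> Y w)"
      by simp_all
    have "vf_deriv \<A> X w p = 0" "vf_deriv \<A> Y w p = 0"
      using zero by (simp_all add: norm_grad_XY)
    with good p have
      "frechet_derivative (vf_deriv \<A> X w \<circ> chart_inv c) (at (snd c p)) = (\<lambda>h. 0)"
      "frechet_derivative (vf_deriv \<A> Y w \<circ> chart_inv c) (at (snd c p)) = (\<lambda>h. 0)"
      by (auto simp: bad_def chart_inv_coord[OF \<A> c p(2)])
    with der[OF X, of p] der[OF Y, of p] p
    have u: "(vf_deriv \<A> X w \<circ> chart_inv c has_derivative (\<lambda>h. 0)) (at (snd c p))"
      and v: "(vf_deriv \<A> Y w \<circ> chart_inv c has_derivative (\<lambda>h. 0)) (at (snd c p))"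
      by auto
    \<comment> \<open>The vanishing differentials remove the first two terms of \<open>E p\<close>,
      and the vanishing differential of the norm removes the other two.\<close>
    have "E p = 0"
      using vf_deriv_eq[OF \<A> X p(1) c p(2) u] vf_deriv_eq[OF \<A> X p(1) c p(2) v]
        vf_deriv_eq[OF \<A> Y p(1) c p(2) u] vf_deriv_eq[OF \<A> Y p(1) c p(2) v]
        vf_deriv_norm_grad_XY_zero[OF \<A> X p(1) c p(2) zero u v]
        vf_deriv_norm_grad_XY_zero[OF \<A> Y p(1) c p(2) zero u v]
      by (simp add: E_def power2_norm_grad_XY)
    with E show False by contradiction
  qed
  then show "negligible (snd c ` (?Z \<inter> fst c))"
    using bad[OF X] bad[OF Y] negligible_Un negligible_subset by blast
qed

theorem mainTheorem1:
  fixes \<A> :: "('m::{t2_space,second_countable_topology}, 'e::euclidean_space) chart set"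
    and \<Delta> :: "('m, 'e) chart \<Rightarrow> 'm \<Rightarrow> 'e set"
    and g :: "('m, 'e) chart \<Rightarrow> 'm \<Rightarrow> 'e \<Rightarrow> 'e \<Rightarrow> real"
    and \<Omega> :: "'m set"
    and X Y :: "('m, 'e) vfield"
    and w :: "'m \<Rightarrow> real"
  assumes "smooth_atlas \<A>"
    and "sub_riemannian \<A> \<Delta> g"
    and "open \<Omega>"
    and "smooth_vector_field \<A> \<Omega> X"
    and "smooth_vector_field \<A> \<Omega> Y"
    and "C2_fun \<A> \<Omega> w"
  shows "(\<forall>p \<in> {p. norm (grad_XY \<A> X Y w p) > 0} \<inter> \<Omega>.
           (norm (grad_XY \<A> X Y (vf_deriv \<A> X w) p))\<^sup>2 + (norm (grad_XY \<A> X Y (vf_deriv \<A> Y w) p))\<^sup>2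
             - \<bar>vf_deriv \<A> X (\<lambda>q. norm (grad_XY \<A> X Y w q)) p\<bar>\<^sup>2
             - \<bar>vf_deriv \<A> Y (\<lambda>q. norm (grad_XY \<A> X Y w q)) p\<bar>\<^sup>2
           = (norm (grad_XY \<A> X Y w p))\<^sup>2 * ((curv_A \<A> X Y w p)\<^sup>2 + (curv_B \<A> X Y w p)\<^sup>2))
       \<and> null_on_manifold \<A>
           {p \<in> {p. norm (grad_XY \<A> X Y w p) = 0} \<inter> \<Omega>.
             (norm (grad_XY \<A> X Y (vf_deriv \<A> X w) p))\<^sup>2 + (norm (grad_XY \<A> X Y (vf_deriv \<A> Y w) p))\<^sup>2
               - \<bar>vf_deriv \<A> X (\<lambda>q. norm (grad_XY \<A> X Y w q)) p\<bar>\<^sup>2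
               - \<bar>vf_deriv \<A> Y (\<lambda>q. norm (grad_XY \<A> X Y w q)) p\<bar>\<^sup>2
             \<noteq> 0}"
proof (intro conjI ballI)
  fix p assume "p \<in> {p. norm (grad_XY \<A> X Y w p) > 0} \<inter> \<Omega>"
  then have p: "p \<in> \<Omega>" "norm (grad_XY \<A> X Y w p) > 0" by blast+
  show "(norm (grad_XY \<A> X Y (vf_deriv \<A> X w) p))\<^sup>2 + (norm (grad_XY \<A> X Y (vf_deriv \<A> Y w) p))\<^sup>2
      - \<bar>vf_deriv \<A> X (\<lambda>q. norm (grad_XY \<A> X Y w q)) p\<bar>\<^sup>2
      - \<bar>vf_deriv \<A> Y (\<lambda>q. norm (grad_XY \<A> X Y w q)) p\<bar>\<^sup>2
    = (norm (grad_XY \<A> X Y w p))\<^sup>2 * ((curv_A \<A> X Y w p)\<^sup>2 + (curv_B \<A> X Y w p)\<^sup>2)"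
    by (rule curvature_identity_at[OF assms(1,3-6) p])
qed (rule null_curvature_defect[OF assms(1,3-6)])

end
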